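(* Let $L/K$ be a finite separable extension of fields, let $E$ be a finite Galois extension of $K$ containing $L$, and let $G=\mathrm{Gal}(E/K)$, $S=\mathrm{Gal}(E/L)$, $X=G/S$. Suppose a skew bracoid $(G,X)$ corresponds to a Hopf-Galois structure on $L/K$. Then $(G,X)$ is almost a brace if and only if $S$ has a normal complement in $G$. If additionally $(G,X)$ is reduced, then $(G,X)$ is almost a brace if and only if the extension $L/K$ is almost classical.
   Context: A skew bracoid $(G,\cdot,N,\star,\odot)$ consists of two groups $(G,\cdot)$ and $(N,\star)$ and a transitive action $\odot$ of $G$ on the set $N$ such that $g\odot(\eta_1\star\eta_2)=(g\odot\eta_1)\star(g\odot e_N)^{-1}\star(g\odot\eta_2)$ for all $g\in G$, $\eta_1,\eta_2\in N$. It is almost a brace if $\mathrm{Stab}_G(e_N)$ has a normal complement $H$ in $G$ ($H$ normal, $G=H\,\mathrm{Stab}_G(e_N)$, trivial intersection). It is reduced if the action $\odot$ is faithful. The notation $(G,X)$ with $X=G/S$ means: $\star$ is a group operation on the set $X$ of left cosets with identity $eS$, and $G$ acts on $X$ by left translation of cosets. There is a known bijection between Hopf-Galois structures on $L/K$ and operations $\star$ on $X$ making $(G,X)$ such a skew bracoid: $\star$ corresponds to the structure with Hopf algebra $E[X,\star]^{G}$, where $G$ acts on $E$ by Galois automorphisms and on $X$ via $\gamma(g)(\bar x)=(g\odot \bar e)^{-1}\star(g\odot\bar x)$, and which acts on $L$ by $\left(\sum_{\bar g\in X}c_{\bar g}\bar g\right)[t]=\sum_{\bar g\in X}c_{\bar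 g}\,g(t)$. It is known that $(G,X)$ is reduced if and only if $E$ is the Galois closure of $L/K$. A finite separable extension $L/K$ with Galois closure $\widetilde E$ is almost classical (almost classically Galois) if $\mathrm{Gal}(\widetilde E/L)$ has a normal complement in $\mathrm{Gal}(\widetilde E/K)$. *)

theory Defs
  imports "HOL-Algebra.Algebra"
begin

section \<open>Skew bracoids\<close>

locale skew_bracoid = group G + N: group N + transitive_action G "carrier N" act
  for G :: "('g, 'x) monoid_scheme" (structure)
    and N :: "('n, 'y) monoid_scheme"
    and act :: "'g \<Rightarrow> 'n \<Rightarrow> 'n" +
  assumes act_mult:
    "\<lbrakk> g \<in> carrier G; a \<in> carrier N; b \<in> carrier N \<rbrakk> \<Longrightarrow>
       act g (a \<otimes>\<^bsub>N\<^esub> b) = act g a \<otimes>\<^bsub>N\<^esub> inv\<^bsub>N\<^esub> (act g \<one>\<^bsub>N\<^esub>) \<otimes>\<^bsub>N\<^esub> act g b"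

definition has_normal_complement :: "('g, 'x) monoid_scheme \<Rightarrow> 'g set \<Rightarrow> bool"
  where "has_normal_complement G S \<longleftrightarrow>
    (\<exists>H. H \<lhd> G \<and> H <#>\<^bsub>G\<^esub> S = carrier G \<and> H \<inter> S = {\<one>\<^bsub>G\<^esub>})"

definition almost_a_brace ::
    "('g, 'x) monoid_scheme \<Rightarrow> ('n, 'y) monoid_scheme \<Rightarrow> ('g \<Rightarrow> 'n \<Rightarrow> 'n) \<Rightarrow> bool"
  where "almost_a_brace G N act \<longleftrightarrow>
    skew_bracoid G N act \<and> has_normal_complement G (stabilizer G act \<one>\<^bsub>N\<^esub>)"

definition reduced_bracoid ::
    "('g, 'x) monoid_scheme \<Rightarrow> ('n, 'y) monoid_scheme \<Rightarrow> ('g \<Rightarrow> 'n \<Rightarrow> 'n) \<Rightarrow> bool"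
  where "reduced_bracoid G N act \<longleftrightarrow>
    skew_bracoid G N act \<and> faithful_action G (carrier N) act"

definition coset_action :: "('g, 'x) monoid_scheme \<Rightarrow> 'g set \<Rightarrow> 'g \<Rightarrow> 'g set \<Rightarrow> 'g set"
  where "coset_action G S = (\<lambda>g. \<lambda>C \<in> lcosets\<^bsub>G\<^esub> S. g <#\<^bsub>G\<^esub> C)"

definition coset_monoid ::
    "('g, 'x) monoid_scheme \<Rightarrow> 'g set \<Rightarrow> ('g set \<Rightarrow> 'g set \<Rightarrow> 'g set) \<Rightarrow> 'g set monoid"
  where "coset_monoid G S star = \<lparr> carrier = lcosets\<^bsub>G\<^esub> S, monoid.mult = star, one = S \<rparr>"


section \<open>Field extensions\<close>

text \<open>Fields are HOL-Algebra structures. Intermediate fields of an extension are represented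
  by their carriers, as subsets of the carrier of the large field.\<close>

definition gal_group :: "('a, 'b) ring_scheme \<Rightarrow> 'a set \<Rightarrow> ('a \<Rightarrow> 'a) monoid"
  where "gal_group E K = BijGroup (carrier E)
    \<lparr> carrier := {s \<in> Bij (carrier E). s \<in> ring_iso E E \<and> (\<forall>k \<in> K. s k = k)} \<rparr>"

definition galois_extension :: "('a, 'b) ring_scheme \<Rightarrow> 'a set \<Rightarrow> bool"
  where "galois_extension E K \<longleftrightarrow>
    field E \<and> subfield K E \<and> ring.finite_dimension E K (carrier E) \<and>
    {x \<in> carrier E. \<forall>s \<in> carrier (gal_group E K). s x = x} = K"

text \<open>The minimal polynomial of every element is required to have only simple roots in an
  algebraic closure (of the large field, hence also of \<open>K\<close> when the extension is algebraic).\<close>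

definition (in field) separable_extension :: "'a set \<Rightarrow> 'a set \<Rightarrow> bool"
  where "separable_extension K L \<longleftrightarrow>
    (\<forall>x \<in> L. algebraic K x \<and>
      (\<forall>a \<in> carrier alg_closure.
         ring.alg_mult alg_closure (map indexed_const (Irr K x)) a \<le> 1))"

text \<open>\<open>M\<close> is the Galois closure of \<open>L/K\<close> inside \<open>E\<close>. Whenever \<open>E/K\<close> is Galois and contains
  \<open>L\<close>, such an \<open>M\<close> exists, and as an extension of \<open>L\<close> it does not depend on \<open>E\<close> up to
  isomorphism.\<close>

definition is_galois_closure :: "('a, 'b) ring_scheme \<Rightarrow> 'a set \<Rightarrow> 'a set \<Rightarrow> 'a set \<Rightarrow> bool"
  where "is_galois_closure E K L M \<longleftrightarrow>
    subfield M E \<and> L \<subseteq> M \<and> galois_extension (E \<lparr> carrier := M \<rparr>) K \<and>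
    (\<forall>M'. subfield M' E \<and> L \<subseteq> M' \<and> galois_extension (E \<lparr> carrier := M' \<rparr>) K \<longrightarrow> M \<subseteq> M')"

definition almost_classical :: "('a, 'b) ring_scheme \<Rightarrow> 'a set \<Rightarrow> 'a set \<Rightarrow> bool"
  where "almost_classical E K L \<longleftrightarrow>
    (\<exists>M. is_galois_closure E K L M \<and>
       has_normal_complement (gal_group (E \<lparr> carrier := M \<rparr>) K)
         (carrier (gal_group (E \<lparr> carrier := M \<rparr>) L)))"

definition subfield_algebra :: "('a, 'b) ring_scheme \<Rightarrow> 'a set \<Rightarrow> ('a, 'a) module"
  where "subfield_algebra E L =
    \<lparr> carrier = L, monoid.mult = (\<otimes>\<^bsub>E\<^esub>), one = \<one>\<^bsub>E\<^esub>,
      ring.zero = \<zero>\<^bsub>E\<^esub>, ring.add = (\<oplus>\<^bsub>E\<^esub>), module.smult = (\<otimes>\<^bsub>E\<^esub>) \<rparr>"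


section \<open>Tensor products\<close>

text \<open>A list \<open>[(x\<^sub>1, y\<^sub>1), \<dots>, (x\<^sub>r, y\<^sub>r)]\<close> stands for the formal sum
  \<open>x\<^sub>1 \<otimes> y\<^sub>1 + \<dots> + x\<^sub>r \<otimes> y\<^sub>r\<close>. The tensor product over \<open>F\<close> consists of the classes of formal
  sums modulo the congruence generated by commutativity and the bilinearity relations. Formal
  negatives are not needed since \<open>(\<ominus> x, y)\<close> is inverse to \<open>(x, y)\<close>.\<close>

inductive tens_eq ::
    "('k, 'c) ring_scheme \<Rightarrow> ('k, 'm, 'x) module_scheme \<Rightarrow> ('k, 'n, 'y) module_scheme \<Rightarrow>
     ('m \<times> 'n) list \<Rightarrow> ('m \<times> 'n) list \<Rightarrow> bool"
  for F M N where
  refl: "set ts \<subseteq> carrier M \<times> carrier N \<Longrightarrow> tens_eq F M N ts ts"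
| sym: "tens_eq F M N ts us \<Longrightarrow> tens_eq F M N us ts"
| trans: "tens_eq F M N ts us \<Longrightarrow> tens_eq F M N us vs \<Longrightarrow> tens_eq F M N ts vs"
| append: "tens_eq F M N ts ts' \<Longrightarrow> tens_eq F M N us us' \<Longrightarrow> tens_eq F M N (ts @ us) (ts' @ us')"
| comm: "set ts \<subseteq> carrier M \<times> carrier N \<Longrightarrow> set us \<subseteq> carrier M \<times> carrier N \<Longrightarrow>
    tens_eq F M N (ts @ us) (us @ ts)"
| zero: "y \<in> carrier N \<Longrightarrow> tens_eq F M N [(\<zero>\<^bsub>M\<^esub>, y)] []"
| add_left: "x \<in> carrier M \<Longrightarrow> x' \<in> carrier M \<Longrightarrow> y \<in> carrier N \<Longrightarrow>
    tens_eq F M N [(x \<oplus>\<^bsub>M\<^esub> x', y)] [(x, y), (x', y)]"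
| add_right: "x \<in> carrier M \<Longrightarrow> y \<in> carrier N \<Longrightarrow> y' \<in> carrier N \<Longrightarrow>
    tens_eq F M N [(x, y \<oplus>\<^bsub>N\<^esub> y')] [(x, y), (x, y')]"
| smult: "a \<in> carrier F \<Longrightarrow> x \<in> carrier M \<Longrightarrow> y \<in> carrier N \<Longrightarrow>
    tens_eq F M N [(a \<odot>\<^bsub>M\<^esub> x, y)] [(x, a \<odot>\<^bsub>N\<^esub> y)]"

definition tens_class ::
    "('k, 'c) ring_scheme \<Rightarrow> ('k, 'm, 'x) module_scheme \<Rightarrow> ('k, 'n, 'y) module_scheme \<Rightarrow>
     ('m \<times> 'n) list \<Rightarrow> ('m \<times> 'n) list set"
  where "tens_class F M N ts = {us. tens_eq F M N ts us}"

abbreviation pure_tens ::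
    "('k, 'c) ring_scheme \<Rightarrow> ('k, 'm, 'x) module_scheme \<Rightarrow> ('k, 'n, 'y) module_scheme \<Rightarrow>
     'm \<Rightarrow> 'n \<Rightarrow> ('m \<times> 'n) list set"
  where "pure_tens F M N x y \<equiv> tens_class F M N [(x, y)]"

definition tens ::
    "('k, 'c) ring_scheme \<Rightarrow> ('k, 'm, 'x) module_scheme \<Rightarrow> ('k, 'n, 'y) module_scheme \<Rightarrow>
     ('k, ('m \<times> 'n) list set) module"
  where "tens F M N =
    \<lparr> carrier = tens_class F M N ` {ts. set ts \<subseteq> carrier M \<times> carrier N},
      monoid.mult = (\<lambda>U V. \<Union>ts \<in> U. \<Union>us \<in> V. tens_class F M N
                [(x \<otimes>\<^bsub>M\<^esub> x', y \<otimes>\<^bsub>N\<^esub> y'). (x, y) \<leftarrow> ts, (x', y') \<leftarrow> us]),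
      one = pure_tens F M N \<one>\<^bsub>M\<^esub> \<one>\<^bsub>N\<^esub>,
      ring.zero = tens_class F M N [],
      ring.add = (\<lambda>U V. \<Union>ts \<in> U. \<Union>us \<in> V. tens_class F M N (ts @ us)),
      module.smult = (\<lambda>a U. \<Union>ts \<in> U. tens_class F M N [(a \<odot>\<^bsub>M\<^esub> x, y). (x, y) \<leftarrow> ts]) \<rparr>"

text \<open>The additive map on the tensor product induced by a balanced biadditive \<open>f\<close> with values
  in \<open>P\<close>; it sends \<open>x \<otimes> y\<close> to \<open>f x y\<close>. For such \<open>f\<close> the sum is the same for all formal sums
  \<open>ts\<close> in a class \<open>U\<close>.\<close>

definition tens_lift ::
    "('p, 'z) ring_scheme \<Rightarrow> ('m \<Rightarrow> 'n \<Rightarrow> 'p) \<Rightarrow> ('m \<times> 'n) list set \<Rightarrow> 'p"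
  where "tens_lift P f U =
    the_elem ((\<lambda>ts. foldr (\<lambda>(x, y) v. f x y \<oplus>\<^bsub>P\<^esub> v) ts \<zero>\<^bsub>P\<^esub>) ` U)"


section \<open>Hopf algebras and Hopf-Galois structures\<close>

definition linear_maps ::
    "('k, 'c) ring_scheme \<Rightarrow> ('k, 'm, 'x) module_scheme \<Rightarrow> ('k, 'n, 'y) module_scheme \<Rightarrow>
     ('m \<Rightarrow> 'n) set"
  where "linear_maps F M N = {f \<in> carrier M \<rightarrow> carrier N.
    (\<forall>x \<in> carrier M. \<forall>y \<in> carrier M. f (x \<oplus>\<^bsub>M\<^esub> y) = f x \<oplus>\<^bsub>N\<^esub> f y) \<and>
    (\<forall>a \<in> carrier F. \<forall>x \<in> carrier M. f (a \<odot>\<^bsub>M\<^esub> x) = a \<odot>\<^bsub>N\<^esub> f x)}"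

text \<open>The library locale \<open>algebra\<close> only covers commutative algebras.\<close>

locale assoc_algebra = module F A + A: ring A
  for F :: "('k, 'c) ring_scheme" and A :: "('k, 'h, 'x) module_scheme" +
  assumes smult_mult_left:
    "\<lbrakk> a \<in> carrier F; x \<in> carrier A; y \<in> carrier A \<rbrakk> \<Longrightarrow>
       (a \<odot>\<^bsub>A\<^esub> x) \<otimes>\<^bsub>A\<^esub> y = a \<odot>\<^bsub>A\<^esub> (x \<otimes>\<^bsub>A\<^esub> y)"
    and smult_mult_right:
    "\<lbrakk> a \<in> carrier F; x \<in> carrier A; y \<in> carrier A \<rbrakk> \<Longrightarrow>
       x \<otimes>\<^bsub>A\<^esub> (a \<odot>\<^bsub>A\<^esub> y) = a \<odot>\<^bsub>A\<^esub> (x \<otimes>\<^bsub>A\<^esub> y)"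

text \<open>Both sides of \<open>coassoc\<close> are taken in \<open>H \<otimes> (H \<otimes> H)\<close>.\<close>

locale hopf_algebra = F: field F + assoc_algebra F H
  for F :: "('k, 'c) ring_scheme" and H :: "('k, 'h, 'x) module_scheme"
    and comult :: "'h \<Rightarrow> ('h \<times> 'h) list set" and counit :: "'h \<Rightarrow> 'k" and antipode :: "'h \<Rightarrow> 'h" +
  assumes comult_hom: "comult \<in> ring_hom H (tens F H H)"
    and comult_linear: "comult \<in> linear_maps F H (tens F H H)"
    and counit_hom: "counit \<in> ring_hom H F"
    and counit_linear:
      "\<lbrakk> a \<in> carrier F; h \<in> carrier H \<rbrakk> \<Longrightarrow> counit (a \<odot>\<^bsub>H\<^esub> h) = a \<otimes>\<^bsub>F\<^esub> counit h"
    and antipode_linear: "antipode \<in> linear_maps F H H"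
    and coassoc: "h \<in> carrier H \<Longrightarrow>
      tens_lift (tens F H (tens F H H))
        (\<lambda>x y. tens_lift (tens F H (tens F H H))
           (\<lambda>u v. pure_tens F H (tens F H H) u (pure_tens F H H v y)) (comult x)) (comult h) =
      tens_lift (tens F H (tens F H H))
        (\<lambda>x y. pure_tens F H (tens F H H) x (comult y)) (comult h)"
    and counit_left: "h \<in> carrier H \<Longrightarrow>
      tens_lift H (\<lambda>x y. counit x \<odot>\<^bsub>H\<^esub> y) (comult h) = h"
    and counit_right: "h \<in> carrier H \<Longrightarrow>
      tens_lift H (\<lambda>x y. counit y \<odot>\<^bsub>H\<^esub> x) (comult h) = h"
    and antipode_left: "h \<in> carrier H \<Longrightarrow>
      tens_lift H (\<lambda>x y. antipode x \<otimes>\<^bsub>H\<^esub> y) (comult h) = counit h \<odot>\<^bsub>H\<^esub> \<one>\<^bsub>H\<^esub>"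
    and antipode_right: "h \<in> carrier H \<Longrightarrow>
      tens_lift H (\<lambda>x y. x \<otimes>\<^bsub>H\<^esub> antipode y) (comult h) = counit h \<odot>\<^bsub>H\<^esub> \<one>\<^bsub>H\<^esub>"

locale hopf_galois_structure = hopf_algebra F H comult counit antipode + L: algebra F L
  for F :: "('k, 'c) ring_scheme" and L :: "('k, 'l, 'y) module_scheme"
    and H :: "('k, 'h, 'x) module_scheme"
    and comult :: "'h \<Rightarrow> ('h \<times> 'h) list set" and counit :: "'h \<Rightarrow> 'k" and antipode :: "'h \<Rightarrow> 'h"
    and act :: "'h \<Rightarrow> 'l \<Rightarrow> 'l" +
  assumes finite_dimensional:
    "\<exists>B. finite B \<and> B \<subseteq> carrier H \<and>
       (\<forall>h \<in> carrier H. \<exists>a \<in> B \<rightarrow> carrier F. h = (\<Oplus>\<^bsub>H\<^esub> b \<in> B. a b \<odot>\<^bsub>H\<^esub> b))"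
    and cocommutative: "h \<in> carrier H \<Longrightarrow>
      tens_lift (tens F H H) (\<lambda>x y. pure_tens F H H y x) (comult h) = comult h"
    and act_linear: "h \<in> carrier H \<Longrightarrow> act h \<in> linear_maps F L L"
    and act_add: "\<lbrakk> h \<in> carrier H; h' \<in> carrier H; t \<in> carrier L \<rbrakk> \<Longrightarrow>
      act (h \<oplus>\<^bsub>H\<^esub> h') t = act h t \<oplus>\<^bsub>L\<^esub> act h' t"
    and act_smult: "\<lbrakk> a \<in> carrier F; h \<in> carrier H; t \<in> carrier L \<rbrakk> \<Longrightarrow>
      act (a \<odot>\<^bsub>H\<^esub> h) t = a \<odot>\<^bsub>L\<^esub> act h t"
    and act_one: "t \<in> carrier L \<Longrightarrow> act \<one>\<^bsub>H\<^esub> t = t"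
    and act_mult: "\<lbrakk> h \<in> carrier H; h' \<in> carrier H; t \<in> carrier L \<rbrakk> \<Longrightarrow>
      act (h \<otimes>\<^bsub>H\<^esub> h') t = act h (act h' t)"
    and measuring_mult: "\<lbrakk> h \<in> carrier H; s \<in> carrier L; t \<in> carrier L \<rbrakk> \<Longrightarrow>
      act h (s \<otimes>\<^bsub>L\<^esub> t) = tens_lift L (\<lambda>x y. act x s \<otimes>\<^bsub>L\<^esub> act y t) (comult h)"
    and measuring_one: "h \<in> carrier H \<Longrightarrow> act h \<one>\<^bsub>L\<^esub> = counit h \<odot>\<^bsub>L\<^esub> \<one>\<^bsub>L\<^esub>"
    and galois_bij:
      "bij_betw (\<lambda>U. \<lambda>t \<in> carrier L. tens_lift L (\<lambda>l h. l \<otimes>\<^bsub>L\<^esub> act h t) U)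
         (carrier (tens F L H)) (linear_maps F L L \<inter> extensional (carrier L))"


section \<open>Group algebras and their invariants\<close>

text \<open>For finite \<open>N\<close>, the element \<open>\<Sum>\<^sub>x c\<^sub>x x\<close> of the group algebra is represented by the
  coefficient function \<open>c\<close>.\<close>

definition group_algebra ::
    "('a, 'b) ring_scheme \<Rightarrow> ('n, 'y) monoid_scheme \<Rightarrow> ('a, 'n \<Rightarrow> 'a) module"
  where "group_algebra E N =
    \<lparr> carrier = carrier N \<rightarrow>\<^sub>E carrier E,
      monoid.mult = (\<lambda>c d. \<lambda>z \<in> carrier N.
        \<Oplus>\<^bsub>E\<^esub> p \<in> {p \<in> carrier N \<times> carrier N. fst p \<otimes>\<^bsub>N\<^esub> snd p = z}. c (fst p) \<otimes>\<^bsub>E\<^esub> d (snd p)),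
      one = (\<lambda>z \<in> carrier N. if z = \<one>\<^bsub>N\<^esub> then \<one>\<^bsub>E\<^esub> else \<zero>\<^bsub>E\<^esub>),
      ring.zero = (\<lambda>z \<in> carrier N. \<zero>\<^bsub>E\<^esub>),
      ring.add = (\<lambda>c d. \<lambda>z \<in> carrier N. c z \<oplus>\<^bsub>E\<^esub> d z),
      module.smult = (\<lambda>a c. \<lambda>z \<in> carrier N. a \<otimes>\<^bsub>E\<^esub> c z) \<rparr>"

definition group_basis :: "('a, 'b) ring_scheme \<Rightarrow> ('n, 'y) monoid_scheme \<Rightarrow> 'n \<Rightarrow> 'n \<Rightarrow> 'a"
  where "group_basis E N x = (\<lambda>z \<in> carrier N. if z = x then \<one>\<^bsub>E\<^esub> else \<zero>\<^bsub>E\<^esub>)"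

definition group_comult ::
    "('a, 'b) ring_scheme \<Rightarrow> ('n, 'y) monoid_scheme \<Rightarrow> ('n \<Rightarrow> 'a) \<Rightarrow>
     (('n \<Rightarrow> 'a) \<times> ('n \<Rightarrow> 'a)) list set"
  where "group_comult E N c =
    (let A = group_algebra E N; T = tens E A A
     in \<Oplus>\<^bsub>T\<^esub> x \<in> carrier N. c x \<odot>\<^bsub>T\<^esub> pure_tens E A A (group_basis E N x) (group_basis E N x))"

definition group_counit :: "('a, 'b) ring_scheme \<Rightarrow> ('n, 'y) monoid_scheme \<Rightarrow> ('n \<Rightarrow> 'a) \<Rightarrow> 'a"
  where "group_counit E N c = (\<Oplus>\<^bsub>E\<^esub> x \<in> carrier N. c x)"

definition group_antipode ::
    "('n, 'y) monoid_scheme \<Rightarrow> ('n \<Rightarrow> 'a) \<Rightarrow> 'n \<Rightarrow> 'a"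
  where "group_antipode N c = (\<lambda>x \<in> carrier N. c (inv\<^bsub>N\<^esub> x))"

definition bracoid_gamma ::
    "('n, 'y) monoid_scheme \<Rightarrow> ('g \<Rightarrow> 'n \<Rightarrow> 'n) \<Rightarrow> 'g \<Rightarrow> 'n \<Rightarrow> 'n"
  where "bracoid_gamma N act g x = inv\<^bsub>N\<^esub> (act g \<one>\<^bsub>N\<^esub>) \<otimes>\<^bsub>N\<^esub> act g x"

text \<open>\<open>\<Sum>\<^sub>x c\<^sub>x x\<close> is sent by \<open>g\<close> to \<open>\<Sum>\<^sub>x g(c\<^sub>x) \<gamma>(g)(x)\<close>.\<close>

definition galois_act_group_algebra ::
    "('a, 'b) ring_scheme \<Rightarrow> ('n, 'y) monoid_scheme \<Rightarrow> (('a \<Rightarrow> 'a) \<Rightarrow> 'n \<Rightarrow> 'n) \<Rightarrow>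
     ('a \<Rightarrow> 'a) \<Rightarrow> ('n \<Rightarrow> 'a) \<Rightarrow> 'n \<Rightarrow> 'a"
  where "galois_act_group_algebra E N act g c =
    (\<lambda>y \<in> carrier N. \<Oplus>\<^bsub>E\<^esub> x \<in> {x \<in> carrier N. bracoid_gamma N act g x = y}. g (c x))"

definition group_algebra_invariants ::
    "('a, 'b) ring_scheme \<Rightarrow> ('a \<Rightarrow> 'a, 'x) monoid_scheme \<Rightarrow> ('n, 'y) monoid_scheme \<Rightarrow>
     (('a \<Rightarrow> 'a) \<Rightarrow> 'n \<Rightarrow> 'n) \<Rightarrow> ('n \<Rightarrow> 'a) set"
  where "group_algebra_invariants E G N act =
    {c \<in> carrier (group_algebra E N).
       \<forall>g \<in> carrier G. galois_act_group_algebra E N act g c = c}"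

text \<open>The value \<open>g(t)\<close> does not depend on the choice of \<open>g\<close> in its left coset modulo
  \<open>Gal(E/L)\<close>, as long as \<open>t\<close> is in \<open>L\<close>.\<close>

definition coset_eval ::
    "('a, 'b) ring_scheme \<Rightarrow> (('a \<Rightarrow> 'a) set, 'y) monoid_scheme \<Rightarrow>
     (('a \<Rightarrow> 'a) set \<Rightarrow> 'a) \<Rightarrow> 'a \<Rightarrow> 'a"
  where "coset_eval E N c t = (\<Oplus>\<^bsub>E\<^esub> C \<in> carrier N. c C \<otimes>\<^bsub>E\<^esub> (SOME g. g \<in> C) t)"

text \<open>The Hopf-Galois structure given by \<open>H\<close>, acting through \<open>actH\<close>, corresponds to the
  operation of \<open>N\<close> on \<open>X = G/S\<close> if \<open>H\<close> is isomorphic to \<open>E[X]\<^sup>G\<close> as a \<open>K\<close>-Hopf algebra acting on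
  \<open>L\<close>. The comultiplication of \<open>E[X]\<^sup>G\<close> is the one which becomes the comultiplication of \<open>E[X]\<close>
  under the canonical injection of \<open>E[X]\<^sup>G \<otimes>\<^sub>K E[X]\<^sup>G\<close> into \<open>E[X] \<otimes>\<^sub>E E[X]\<close>.\<close>

definition corresponds_to_bracoid ::
    "('a, 'b) ring_scheme \<Rightarrow> 'a set \<Rightarrow> 'a set \<Rightarrow> ('a \<Rightarrow> 'a) monoid \<Rightarrow> ('a \<Rightarrow> 'a) set monoid \<Rightarrow>
     (('a \<Rightarrow> 'a) \<Rightarrow> ('a \<Rightarrow> 'a) set \<Rightarrow> ('a \<Rightarrow> 'a) set) \<Rightarrow>
     ('a, 'h, 'x) module_scheme \<Rightarrow> ('h \<Rightarrow> ('h \<times> 'h) list set) \<Rightarrow> ('h \<Rightarrow> 'a) \<Rightarrow> ('h \<Rightarrow> 'h) \<Rightarrow>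
     ('h \<Rightarrow> 'a \<Rightarrow> 'a) \<Rightarrow> bool"
  where "corresponds_to_bracoid E K L G N actG H comult counit antipode actH \<longleftrightarrow>
    (let A = group_algebra E N in
     \<exists>f. f \<in> ring_hom H A \<and>
       bij_betw f (carrier H) (group_algebra_invariants E G N actG) \<and>
       (\<forall>a \<in> K. \<forall>h \<in> carrier H. f (a \<odot>\<^bsub>H\<^esub> h) = a \<odot>\<^bsub>A\<^esub> f h) \<and>
       (\<forall>h \<in> carrier H.
          tens_lift (tens E A A) (\<lambda>x y. pure_tens E A A (f x) (f y)) (comult h) =
            group_comult E N (f h) \<and>
          counit h = group_counit E N (f h) \<and>
          f (antipode h) = group_antipode N (f h) \<and>
          (\<forall>t \<in> L. actH h t = coset_eval E N (f h) t)))"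

end

theory Submission
  imports Defs
begin

text \<open>In \<open>G/S\<close> with left translation the stabilizer of the trivial coset, the identity of the
  bracoid, is \<open>S\<close> itself, so being almost a brace means precisely that \<open>S\<close> has a normal
  complement in \<open>G\<close>. This is \<open>stabilizer_coset_action\<close>.

  For a reduced bracoid it remains to see that the Galois closure of \<open>L/K\<close> in \<open>E\<close> is \<open>E\<close>. Let \<open>M\<close>
  be a subfield of \<open>E\<close> that contains \<open>L\<close> and is Galois over \<open>K\<close>. Every element of \<open>G\<close> maps \<open>M\<close>
  into itself, hence all conjugates of an element of \<open>Gal(E/M)\<close> fix \<open>M\<close>, and so lie in \<open>S\<close>. Since
  \<open>G\<close> acts faithfully on \<open>G/S\<close>, no nontrivial element has all its conjugates in \<open>S\<close>. So
  \<open>Gal(E/M)\<close> is trivial, and \<open>M = E\<close>.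

  The two facts from Galois theory used here, that \<open>G\<close> preserves \<open>M\<close>
  (\<open>galois_subextension_stable\<close>) and that \<open>M = E\<close> if \<open>Gal(E/M)\<close> is trivial
  (\<open>galois_subextension_eq_carrier\<close>), both follow from a relative form of Dedekind's theorem on
  the independence of characters (\<open>character_coefficient_in_subspace\<close>), applied to sums of
  conjugates, which lie in \<open>K\<close>. These sums are
  finite because a finite extension has only finitely many automorphisms
  (\<open>finite_gal_group\<close>).\<close>

section \<open>Characters with values in a field\<close>

text \<open>For \<open>W = {0}\<close> this is Dedekind's theorem that distinct characters are linearly independent.
  The usual elimination also works modulo a subspace \<open>W\<close> over a subfield \<open>B\<close>, as long as the
  characters take values in \<open>B\<close>: if \<open>x\<close> separates \<open>\<chi>\<^sub>j\<close> from \<open>\<chi>\<^bsub>i\<^sub>0\<^esub>\<close>, then multiplying the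
  coefficient at each \<open>i\<close> by \<open>(\<chi>\<^sub>j x - \<chi>\<^sub>i x) / (\<chi>\<^sub>j x - \<chi>\<^bsub>i\<^sub>0\<^esub> x)\<close> removes the term of \<open>j\<close>,
  keeps the coefficient at \<open>i\<^sub>0\<close>, and keeps all sums in \<open>W\<close>. In the end only the term of
  \<open>i\<^sub>0\<close> is left.\<close>

lemma (in field) character_coefficient_in_subspace:
  fixes M :: "('m, 'c) monoid_scheme" and \<chi> :: "'i \<Rightarrow> 'm \<Rightarrow> 'a"
  assumes "monoid M" and B: "subfield B R"
    and W: "W \<subseteq> carrier R" "\<And>u w. u \<in> W \<Longrightarrow> w \<in> W \<Longrightarrow> u \<ominus> w \<in> W"
      "\<And>b w. b \<in> B \<Longrightarrow> w \<in> W \<Longrightarrow> b \<otimes> w \<in> W"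
    and I: "finite I" "i\<^sub>0 \<in> I"
    and \<chi>_hom: "\<And>i. i \<in> I \<Longrightarrow> \<chi> i \<in> hom M R" "\<And>i. i \<in> I \<Longrightarrow> \<chi> i \<one>\<^bsub>M\<^esub> = \<one>"
    and \<chi>_B: "\<And>i x. i \<in> I \<Longrightarrow> x \<in> carrier M \<Longrightarrow> \<chi> i x \<in> B"
    and distinct: "\<And>i. i \<in> I - {i\<^sub>0} \<Longrightarrow> \<exists>x \<in> carrier M. \<chi> i x \<noteq> \<chi> i\<^sub>0 x"
    and v: "v \<in> I \<rightarrow> carrier R"
    and sums: "\<And>a. a \<in> carrier M \<Longrightarrow> (\<Oplus>i \<in> I. v i \<otimes> \<chi> i a) \<in> W"
  shows "v i\<^sub>0 \<in> W"
proof -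
  interpret M: monoid M by fact
  have BR: "B \<subseteq> carrier R" using subfieldE(3)[OF B] .
  have \<chi>_R: "\<chi> i x \<in> carrier R" if "i \<in> I" "x \<in> carrier M" for i x
    using \<chi>_B[OF that] BR by blast
  have \<chi>_mult: "\<chi> i (x \<otimes>\<^bsub>M\<^esub> y) = \<chi> i x \<otimes> \<chi> i y"
    if "i \<in> I" "x \<in> carrier M" "y \<in> carrier M" for i x y
    using \<chi>_hom(1)[OF that(1)] that by (auto simp: hom_def)
  \<comment> \<open>\<open>T\<close> is the set of indices that have already been eliminated.\<close>
  have "\<exists>c. c \<in> I \<rightarrow> carrier R \<and> c i\<^sub>0 = v i\<^sub>0 \<and> (\<forall>i \<in> T. c i = \<zero>) \<and>
      (\<forall>a \<in> carrier M. (\<Oplus>i \<in> I. c i \<otimes> \<chi> i a) \<in> W)"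
    if "finite T" "T \<subseteq> I - {i\<^sub>0}" for T
    using that
  proof (induction T)
    case empty
    then show ?case using v sums by auto
  next
    case (insert j T)
    then obtain c where c: "c \<in> I \<rightarrow> carrier R" "c i\<^sub>0 = v i\<^sub>0" "\<And>i. i \<in> T \<Longrightarrow> c i = \<zero>"
      and c_sums: "\<And>a. a \<in> carrier M \<Longrightarrow> (\<Oplus>i \<in> I. c i \<otimes> \<chi> i a) \<in> W" by auto
    have j: "j \<in> I - {i\<^sub>0}" using insert.prems by auto
    obtain x where x: "x \<in> carrier M" "\<chi> j x \<noteq> \<chi> i\<^sub>0 x" using distinct[OF j] by auto
    have cR: "c i \<in> carrier R" if "i \<in> I" for i using c(1) that by auto
    have jx: "\<chi> j x \<in> B" "\<chi> i\<^sub>0 x \<in> B" using \<chi>_B j I(2) x(1) by auto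
    define e where "e = \<chi> j x \<ominus> \<chi> i\<^sub>0 x"
    have "e \<in> B" unfolding e_def a_minus_def
      using jx subringE(5,7)[OF subfieldE(1)[OF B]] by auto
    moreover have "e \<noteq> \<zero>" unfolding e_def using x(2) jx BR by (simp add: subset_iff)
    ultimately have e: "inv e \<in> B" "inv e \<otimes> e = \<one>" "inv e \<in> carrier R"
      using subfield_m_inv[OF B, of e] BR by auto
    define c' where "c' i = inv e \<otimes> ((\<chi> j x \<ominus> \<chi> i x) \<otimes> c i)" for i
    have c'R: "c' \<in> I \<rightarrow> carrier R"
      unfolding c'_def using e cR \<chi>_R[OF _ x(1)] j by auto
    \<comment> \<open>The new sum at \<open>a\<close> combines the old sums at \<open>a\<close> and at \<open>x a\<close>.\<close>
    have "(\<Oplus>i \<in> I. c' i \<otimes> \<chi> i a) \<in> W" if a: "a \<in> carrier M" for a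
    proof -
      have jR: "\<chi> j x \<in> carrier R" using jx BR by auto
      have "c' i \<otimes> \<chi> i a = inv e \<otimes> (\<chi> j x \<otimes> (c i \<otimes> \<chi> i a) \<ominus> c i \<otimes> \<chi> i (x \<otimes>\<^bsub>M\<^esub> a))"
        if i: "i \<in> I" for i
        unfolding c'_def \<chi>_mult[OF i x(1) a]
        using e(3) jR cR[OF i] \<chi>_R[OF i x(1)] \<chi>_R[OF i a] by algebra
      then have "(\<Oplus>i \<in> I. c' i \<otimes> \<chi> i a) =
          (\<Oplus>i \<in> I. inv e \<otimes> (\<chi> j x \<otimes> (c i \<otimes> \<chi> i a) \<ominus> c i \<otimes> \<chi> i (x \<otimes>\<^bsub>M\<^esub> a)))"
        using e jR cR \<chi>_R a x(1) by (intro finsum_cong') auto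
      also have "\<dots> = inv e \<otimes> (\<Oplus>i \<in> I. \<chi> j x \<otimes> (c i \<otimes> \<chi> i a) \<ominus> c i \<otimes> \<chi> i (x \<otimes>\<^bsub>M\<^esub> a))"
        using e jR cR \<chi>_R a x(1) I by (intro finsum_rdistr[symmetric]) auto
      also have "(\<Oplus>i \<in> I. \<chi> j x \<otimes> (c i \<otimes> \<chi> i a) \<ominus> c i \<otimes> \<chi> i (x \<otimes>\<^bsub>M\<^esub> a)) =
          (\<Oplus>i \<in> I. \<chi> j x \<otimes> (c i \<otimes> \<chi> i a)) \<oplus> (\<Oplus>i \<in> I. \<ominus> (c i \<otimes> \<chi> i (x \<otimes>\<^bsub>M\<^esub> a)))"
        unfolding a_minus_def using jR cR \<chi>_R a x(1) I by (intro finsum_addf) auto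
      also have "(\<Oplus>i \<in> I. \<ominus> (c i \<otimes> \<chi> i (x \<otimes>\<^bsub>M\<^esub> a))) = (\<Oplus>i \<in> I. \<ominus> \<one> \<otimes> (c i \<otimes> \<chi> i (x \<otimes>\<^bsub>M\<^esub> a)))"
        using cR \<chi>_R a x(1) I by (intro finsum_cong') (auto simp: l_minus)
      also have "\<dots> = \<ominus> \<one> \<otimes> (\<Oplus>i \<in> I. (c i \<otimes> \<chi> i (x \<otimes>\<^bsub>M\<^esub> a)))"
        using cR \<chi>_R a x(1) I by (intro finsum_rdistr[symmetric]) auto
      also have "\<dots> = \<ominus> (\<Oplus>i \<in> I. (c i \<otimes> \<chi> i (x \<otimes>\<^bsub>M\<^esub> a)))"
        using cR \<chi>_R a x(1) by (subst l_minus) (auto intro!: finsum_closed)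
      also have "(\<Oplus>i \<in> I. \<chi> j x \<otimes> (c i \<otimes> \<chi> i a)) = \<chi> j x \<otimes> (\<Oplus>i \<in> I. c i \<otimes> \<chi> i a)"
        using jR cR \<chi>_R a I by (intro finsum_rdistr[symmetric]) auto
      finally have "(\<Oplus>i \<in> I. c' i \<otimes> \<chi> i a) =
        inv e \<otimes> (\<chi> j x \<otimes> (\<Oplus>i \<in> I. c i \<otimes> \<chi> i a) \<ominus> (\<Oplus>i \<in> I. c i \<otimes> \<chi> i (x \<otimes>\<^bsub>M\<^esub> a)))"
        unfolding a_minus_def .
      then show ?thesis using W(2,3) e(1) jx(1) c_sums a x(1) by simp
    qed
    moreover have "c' i\<^sub>0 = v i\<^sub>0"
    proof -
      have "c' i\<^sub>0 = (inv e \<otimes> e) \<otimes> c i\<^sub>0"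
        unfolding c'_def e_def[symmetric] using e \<open>e \<in> B\<close> BR cR I(2) by (subst m_assoc) auto
      then show ?thesis using e c(2) cR[OF I(2)] by simp
    qed
    moreover have "c' i = \<zero>" if "i \<in> insert j T" for i
    proof (cases "i = j")
      case True
      then show ?thesis
        unfolding c'_def using jx(1) BR e(3) cR[of j] j by (auto simp: a_minus_def r_neg subset_iff)
    next
      case False
      then have "c i = \<zero>" using c(3) that by auto
      moreover have "\<chi> i x \<in> carrier R" using that insert.prems \<chi>_R x(1) by blast
      ultimately show ?thesis unfolding c'_def using e jx BR by auto
    qed
    ultimately show ?case using c'R by (intro exI[of _ c']) auto
  qed
  from this[of "I - {i\<^sub>0}"] I(1)
  obtain c where c: "c \<in> I \<rightarrow> carrier R" "c i\<^sub>0 = v i\<^sub>0" "\<And>i. i \<in> I - {i\<^sub>0} \<Longrightarrow> c i = \<zero>"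
    and c_sums: "\<And>a. a \<in> carrier M \<Longrightarrow> (\<Oplus>i \<in> I. c i \<otimes> \<chi> i a) \<in> W" by auto
  have "(\<Oplus>i \<in> I. c i \<otimes> \<chi> i \<one>\<^bsub>M\<^esub>) = (\<Oplus>i \<in> I. if i\<^sub>0 = i then v i else \<zero>)"
    using c \<chi>_hom(2) v by (intro finsum_cong') (auto simp: Pi_iff)
  also have "\<dots> = v i\<^sub>0"
    using I v by (intro finsum_singleton) auto
  finally show ?thesis using c_sums[of "\<one>\<^bsub>M\<^esub>"] by simp
qed


section \<open>Galois groups\<close>

lemma carrier_gal_group:
  "carrier (gal_group E K) =
    {s \<in> extensional (carrier E). s \<in> ring_iso E E \<and> (\<forall>k \<in> K. s k = k)}"
  by (auto simp: gal_group_def Bij_def ring_iso_def)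

lemma gal_groupD:
  assumes "s \<in> carrier (gal_group E K)"
  shows "s \<in> extensional (carrier E)" "s \<in> ring_iso E E" "s \<in> ring_hom E E"
    "\<And>k. k \<in> K \<Longrightarrow> s k = k" "\<And>x. x \<in> carrier E \<Longrightarrow> s x \<in> carrier E"
  using assms by (auto simp: carrier_gal_group ring_iso_def ring_hom_def)

lemma mult_gal_group:
  assumes "s \<in> carrier (gal_group E K)" "t \<in> carrier (gal_group E K)"
  shows "s \<otimes>\<^bsub>gal_group E K\<^esub> t = compose (carrier E) s t"
  using assms by (simp add: gal_group_def BijGroup_def)

lemma one_gal_group: "\<one>\<^bsub>gal_group E K\<^esub> = (\<lambda>x \<in> carrier E. x)"
  by (simp add: gal_group_def BijGroup_def)

lemma subgroup_gal_group:
  assumes "ring E" "K \<subseteq> carrier E"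
  shows "subgroup (carrier (gal_group E K)) (BijGroup (carrier E))"
proof -
  interpret E: ring E by fact
  interpret B: group "BijGroup (carrier E)" by (rule group_BijGroup)
  have sub: "carrier (gal_group E K) \<subseteq> Bij (carrier E)"
    by (auto simp: gal_group_def)
  show ?thesis
  proof (rule B.subgroupI)
    show "carrier (gal_group E K) \<subseteq> carrier (BijGroup (carrier E))"
      using sub by (simp add: BijGroup_def)
    have "(\<lambda>x \<in> carrier E. x) \<in> carrier (gal_group E K)"
      using assms(2) by (auto simp: carrier_gal_group ring_iso_def ring_hom_def bij_betw_def inj_on_def)
    then show "carrier (gal_group E K) \<noteq> {}" by auto
  next
    fix s assume s: "s \<in> carrier (gal_group E K)"
    let ?t = "\<lambda>x \<in> carrier E. inv_into (carrier E) s x"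
    have inj: "inj_on s (carrier E)"
      using gal_groupD(2)[OF s] by (auto simp: ring_iso_def bij_betw_def)
    have "?t \<in> ring_iso E E"
      using E.ring_iso_restrict[OF ring_iso_set_sym[OF assms(1) gal_groupD(2)[OF s]]] by auto
    moreover have "?t k = k" if "k \<in> K" for k
      using that assms(2) gal_groupD(4)[OF s that] inv_into_f_f[OF inj, of k] by auto
    ultimately show "inv\<^bsub>BijGroup (carrier E)\<^esub> s \<in> carrier (gal_group E K)"
      using sub s by (auto simp: inv_BijGroup carrier_gal_group)
  next
    fix s t assume st: "s \<in> carrier (gal_group E K)" "t \<in> carrier (gal_group E K)"
    have "compose (carrier E) s t \<in> ring_iso E E"
      using E.ring_iso_restrict[OF ring_iso_set_trans[OF gal_groupD(2)[OF st(2)] gal_groupD(2)[OF st(1)]]]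
      by (auto simp: compose_def)
    then show "s \<otimes>\<^bsub>BijGroup (carrier E)\<^esub> t \<in> carrier (gal_group E K)"
      using st sub assms(2) gal_groupD(4)[OF st(1)] gal_groupD(4)[OF st(2)]
      by (auto simp: BijGroup_def carrier_gal_group compose_def subset_iff)
  qed
qed

lemma group_gal_group:
  assumes "ring E" "K \<subseteq> carrier E"
  shows "group (gal_group E K)"
  using subgroup.subgroup_is_group[OF subgroup_gal_group[OF assms] group_BijGroup]
  by (simp add: gal_group_def)

lemma gal_group_subgroup_mono:
  assumes "ring E" "K \<subseteq> L" "L \<subseteq> carrier E"
  shows "subgroup (carrier (gal_group E L)) (gal_group E K)"
proof -
  have "subgroup (carrier (gal_group E L)) (BijGroup (carrier E)\<lparr>carrier := carrier (gal_group E K)\<rparr>)"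
    using assms subgroup_gal_group[of E K] subgroup_gal_group[of E L]
    by (intro group.subgroup_incl[OF group_BijGroup]) (auto simp: carrier_gal_group)
  then show ?thesis by (simp add: gal_group_def)
qed

text \<open>An automorphism is determined by its values on a finite spanning set, and it can only send
  an element to a root of a polynomial over \<open>K\<close> that this element satisfies.\<close>

lemma finite_gal_group:
  assumes "field E" and K: "subfield K E" and fin: "ring.finite_dimension E K (carrier E)"
  shows "finite (carrier (gal_group E K))"
proof -
  interpret E: field E by fact
  obtain Us where Us: "set Us \<subseteq> carrier E" "E.Span K Us = carrier E"
    using fin E.exists_base[OF K] unfolding E.finite_dimension_def by metis
  have hom: "ring_hom_ring E E s" if "s \<in> carrier (gal_group E K)" for s
    using gal_groupD(3)[OF that] E.ring_axioms by (simp add: ring_hom_ringI2)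
  have "\<exists>Z. finite Z \<and> (\<forall>s \<in> carrier (gal_group E K). s u \<in> Z)" if u: "u \<in> carrier E" for u
  proof -
    have "E.algebraic K u"
      using E.finite_dimension_imp_algebraic[OF K E.carrier_is_subring fin u] by (simp add: over_def)
    then obtain p where p: "p \<in> carrier (K[X]\<^bsub>E\<^esub>)" "p \<noteq> []" "E.eval p u = \<zero>\<^bsub>E\<^esub>"
      using E.algebraicE[OF subfieldE(1)[OF K] u] by (auto simp: over_def)
    have pE: "p \<in> carrier (poly_ring E)"
      using p(1) E.carrier_polynomial_shell subfieldE(1)[OF K] by blast
    have pK: "set p \<subseteq> K"
      using p(1) by (auto simp: polynomial_def univ_poly_carrier[symmetric])
    have "s u \<in> {x. E.is_root p x}" if s: "s \<in> carrier (gal_group E K)" for s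
    proof -
      interpret s: ring_hom_ring E E s by (rule hom[OF s])
      have "map s p = p" using gal_groupD(4)[OF s] pK by (auto intro: map_idI)
      then have "E.eval p (s u) = s (E.eval p u)"
        using s.eval_hom[OF subfieldE(1)[OF K] u p(1)] by simp
      then show ?thesis using p u s.hom_closed by (auto simp: E.is_root_def)
    qed
    then show ?thesis using E.finite_number_of_roots[OF pE] by blast
  qed
  then obtain Z where Z: "\<And>u. u \<in> carrier E \<Longrightarrow> finite (Z u)"
    "\<And>u s. u \<in> carrier E \<Longrightarrow> s \<in> carrier (gal_group E K) \<Longrightarrow> s u \<in> Z u" by metis
  have combine: "s (E.combine Ks Vs) = E.combine Ks (map s Vs)"
    if s: "s \<in> carrier (gal_group E K)" and "set Ks \<subseteq> K" "set Vs \<subseteq> carrier E" for s Ks Vs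
    using that(2,3)
  proof (induction Ks Vs rule: E.combine.induct)
    case (1 k Ks u Us)
    interpret s: ring_hom_ring E E s by (rule hom[OF s])
    show ?case using 1 subfieldE(3)[OF K] gal_groupD(4)[OF s]
      by (auto simp: E.combine_in_carrier subset_iff)
  qed (use ring_hom_zero[OF gal_groupD(3)[OF s] E.ring_axioms E.ring_axioms] in auto)
  have "inj_on (\<lambda>s. restrict s (set Us)) (carrier (gal_group E K))"
  proof (rule inj_onI)
    fix s t assume s: "s \<in> carrier (gal_group E K)" and t: "t \<in> carrier (gal_group E K)"
      and eq: "restrict s (set Us) = restrict t (set Us)"
    have "map s Us = map t Us" using eq by (auto simp: restrict_def fun_eq_iff) metis
    moreover have "\<exists>Ks. set Ks \<subseteq> K \<and> x = E.combine Ks Us" if "x \<in> carrier E" for x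
      using E.Span_eq_combine_set[OF K Us(1)] that unfolding Us(2) by blast
    ultimately have "s x = t x" if "x \<in> carrier E" for x
      using combine[OF s _ Us(1)] combine[OF t _ Us(1)] that by metis
    then show "s = t"
      using gal_groupD(1)[OF s] gal_groupD(1)[OF t] by (rule extensionalityI[rotated 2])
  qed
  moreover have "(\<lambda>s. restrict s (set Us)) ` carrier (gal_group E K) \<subseteq> (\<Pi>\<^sub>E u \<in> set Us. Z u)"
    using Z(2) Us(1) by auto
  moreover have "finite (\<Pi>\<^sub>E u \<in> set Us. Z u)" using Z(1) Us(1) by (intro finite_PiE) auto
  ultimately show ?thesis by (meson finite_imageD finite_subset)
qed

text \<open>An automorphism permutes the conjugates of \<open>w\<close> and so fixes their sum, and \<open>K\<close> is the
  whole fixed field of the Galois group.\<close>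

lemma trace_in_fixed_field:
  assumes gal: "galois_extension E K" and w: "w \<in> carrier E"
  shows "(\<Oplus>\<^bsub>E\<^esub> s \<in> carrier (gal_group E K). s w) \<in> K"
proof -
  let ?G = "gal_group E K"
  interpret E: field E using gal by (simp add: galois_extension_def)
  have K: "K \<subseteq> carrier E" using gal subfieldE(3) by (auto simp: galois_extension_def)
  interpret G: group ?G by (rule group_gal_group[OF E.ring_axioms K])
  let ?t = "\<Oplus>\<^bsub>E\<^esub> s \<in> carrier ?G. s w"
  have "g ?t = ?t" if g: "g \<in> carrier ?G" for g
  proof -
    interpret g: ring_hom_ring E E g
      using gal_groupD(3)[OF g] E.ring_axioms by (simp add: ring_hom_ringI2)
    have "g ?t = (\<Oplus>\<^bsub>E\<^esub> s \<in> carrier ?G. g (s w))"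
      using gal_groupD(5) w by (subst g.hom_finsum) (auto simp: comp_def)
    also have "\<dots> = (\<Oplus>\<^bsub>E\<^esub> s \<in> carrier ?G. (g \<otimes>\<^bsub>?G\<^esub> s) w)"
      using w gal_groupD(5)[OF g] gal_groupD(5)[of _ E K w] g
      by (intro E.finsum_cong') (auto simp: mult_gal_group compose_def)
    also have "\<dots> = (\<Oplus>\<^bsub>E\<^esub> s \<in> (\<lambda>s. g \<otimes>\<^bsub>?G\<^esub> s) ` carrier ?G. s w)"
      using gal_groupD(5)[of _ E K w] w G.m_closed[OF g] G.inj_on_cmult[OF g]
      by (intro E.finsum_reindex[symmetric]) auto
    also have "(\<lambda>s. g \<otimes>\<^bsub>?G\<^esub> s) ` carrier ?G = carrier ?G"
      using g by (rule G.surj_const_mult)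
    finally show ?thesis .
  qed
  moreover have "?t \<in> carrier E" using gal_groupD(5) w by (intro E.finsum_closed) auto
  ultimately show ?thesis using gal by (auto simp: galois_extension_def)
qed


section \<open>Galois subextensions\<close>

lemma finsum_subring:
  assumes "ring E" "subring M E" "f \<in> A \<rightarrow> M"
  shows "(\<Oplus>\<^bsub>E\<lparr>carrier := M\<rparr>\<^esub> i \<in> A. f i) = (\<Oplus>\<^bsub>E\<^esub> i \<in> A. f i)"
proof -
  interpret E: ring E by fact
  interpret F: ring "E\<lparr>carrier := M\<rparr>" by (rule E.subring_is_ring[OF assms(2)])
  have ME: "M \<subseteq> carrier E" using subringE(1)[OF assms(2)] .
  show ?thesis
    using assms(3)
  proof (induction A rule: infinite_finite_induct)
    case (insert i A)
    then have "f \<in> A \<rightarrow> carrier E" "f i \<in> carrier E" using ME by auto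
    with insert show ?case by (subst F.finsum_insert) (auto simp: E.finsum_insert)
  qed (auto simp: E.finsum_infinite F.finsum_infinite)
qed

text \<open>The trace \<open>t\<close> of \<open>a\<close> from \<open>M\<close> to \<open>K\<close> satisfies \<open>g t = t\<close>. With \<open>h\<close> ranging over \<open>Gal(M/K)\<close>
  this says that the sum of all \<open>h a\<close> equals the sum of all \<open>g (h a)\<close>, which is a linear relation
  between the characters \<open>h\<close> and \<open>g \<circ> h\<close> of \<open>M\<close>. If \<open>g\<close> did not map \<open>M\<close> into itself, then its
  restriction to \<open>M\<close> would differ from all the other characters and have coefficient \<open>-1\<close>,
  contrary to their independence.\<close>

lemma galois_subextension_stable:
  assumes "field E" and M: "subfield M E"
    and gal: "galois_extension (E\<lparr>carrier := M\<rparr>) K"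
    and g: "g \<in> carrier (gal_group E K)" and y: "y \<in> M"
  shows "g y \<in> M"
proof (rule ccontr)
  assume gy: "g y \<notin> M"
  interpret E: field E by fact
  let ?F = "E\<lparr>carrier := M\<rparr>"
  define \<Gamma> where "\<Gamma> = carrier (gal_group ?F K)"
  interpret F: field ?F using gal by (simp add: galois_extension_def)
  interpret g: ring_hom_ring E E g
    using gal_groupD(3)[OF g] E.ring_axioms by (simp add: ring_hom_ringI2)
  have ME: "M \<subseteq> carrier E" using subfieldE(3)[OF M] .
  have KF: "subfield K ?F" "ring.finite_dimension ?F K (carrier ?F)"
    using gal by (auto simp: galois_extension_def)
  have KM: "K \<subseteq> M" using subfieldE(3)[OF KF(1)] by simp
  interpret \<Gamma>: group "gal_group ?F K" using group_gal_group[OF F.ring_axioms] KM by simp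
  have inj: "inj_on g (carrier E)"
    using gal_groupD(2)[OF g] by (auto simp: ring_iso_def bij_betw_def)
  have fin: "finite \<Gamma>" unfolding \<Gamma>_def using finite_gal_group[OF F.field_axioms KF] .
  have hM: "h a \<in> M" if "h \<in> \<Gamma>" "a \<in> M" for h a
    using gal_groupD(5)[of h ?F K a] that by (simp add: \<Gamma>_def)
  then have hE: "h a \<in> carrier E" if "h \<in> \<Gamma>" "a \<in> M" for h a using ME that by blast
  have h_hom: "h \<in> ring_hom ?F ?F" if "h \<in> \<Gamma>" for h using that gal_groupD(3) by (auto simp: \<Gamma>_def)
  have h_mult: "h (a \<otimes>\<^bsub>E\<^esub> b) = h a \<otimes>\<^bsub>E\<^esub> h b" if "h \<in> \<Gamma>" "a \<in> M" "b \<in> M" for h a b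
    using ring_hom_mult[OF h_hom[OF that(1)], of a b] that by simp
  define i where "i = \<one>\<^bsub>gal_group ?F K\<^esub>"
  have i: "i \<in> \<Gamma>" "\<And>a. a \<in> M \<Longrightarrow> i a = a"
    by (simp_all only: i_def \<Gamma>_def \<Gamma>.one_closed) (simp add: one_gal_group)
  \<comment> \<open>\<open>Inl h\<close> stands for the character \<open>h\<close> and \<open>Inr h\<close> for \<open>g \<circ> h\<close>; the sum type keeps the two
    families apart even where they could coincide.\<close>
  define \<chi> where "\<chi> = case_sum (\<lambda>h. h) (\<lambda>h (a :: 'a). g (h a))"
  define v where "v = case_sum (\<lambda>h :: 'a \<Rightarrow> 'a. \<one>\<^bsub>E\<^esub>) (\<lambda>h :: 'a \<Rightarrow> 'a. \<ominus>\<^bsub>E\<^esub> \<one>\<^bsub>E\<^esub>)"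
  have \<chi>E: "\<chi> j a \<in> carrier E" if "j \<in> \<Gamma> <+> \<Gamma>" "a \<in> M" for j a
    using that hE by (auto simp: \<chi>_def)
  have "v (Inr i) \<in> {\<zero>\<^bsub>E\<^esub>}"
  proof (rule E.character_coefficient_in_subspace[where M = ?F and B = "carrier E" and \<chi> = \<chi>
        and I = "\<Gamma> <+> \<Gamma>"])
    fix j assume "j \<in> \<Gamma> <+> \<Gamma>"
    then obtain h where h: "h \<in> \<Gamma>" and j: "j = Inl h \<or> j = Inr h" by auto
    show "\<chi> j \<in> hom ?F E"
      using j hE[OF h] h_mult[OF h] by (auto simp: hom_def \<chi>_def)
    show "\<chi> j \<one>\<^bsub>?F\<^esub> = \<one>\<^bsub>E\<^esub>"
      using j ring_hom_one[OF h_hom[OF h]] by (auto simp: \<chi>_def)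
  next
    show "\<exists>x \<in> carrier ?F. \<chi> j x \<noteq> \<chi> (Inr i) x" if "j \<in> (\<Gamma> <+> \<Gamma>) - {Inr i}" for j
    proof (cases j)
      case (Inl h)
      then have "h y \<noteq> g y" using hM[of h y] gy y that by auto
      then show ?thesis using Inl y i by (auto simp: \<chi>_def intro!: bexI[of _ y])
    next
      case (Inr h)
      then have h: "h \<in> \<Gamma>" "h \<noteq> i" using that by auto
      have "\<exists>x \<in> M. h x \<noteq> i x"
        using extensionalityI[of h M i] gal_groupD(1)[of h ?F K] gal_groupD(1)[of i ?F K] h i(1)
        by (auto simp: \<Gamma>_def)
      then obtain x where "x \<in> M" "h x \<noteq> i x" by auto
      then have "g (h x) \<noteq> g (i x)" using inj hE h i(1) by (auto dest: inj_onD)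
      then show ?thesis using Inr \<open>x \<in> M\<close> by (auto simp: \<chi>_def)
    qed
    show "(\<Oplus>\<^bsub>E\<^esub> j \<in> \<Gamma> <+> \<Gamma>. v j \<otimes>\<^bsub>E\<^esub> \<chi> j a) \<in> {\<zero>\<^bsub>E\<^esub>}" if "a \<in> carrier ?F" for a
    proof -
      from that have a: "a \<in> M" by simp
      let ?t = "\<Oplus>\<^bsub>E\<^esub> h \<in> \<Gamma>. h a"
      have tE: "?t \<in> carrier E" using hE a by (intro E.finsum_closed) auto
      have "?t = (\<Oplus>\<^bsub>?F\<^esub> h \<in> \<Gamma>. h a)"
        using finsum_subring[OF E.ring_axioms subfieldE(1)[OF M], of "\<lambda>h. h a" \<Gamma>] hM a by auto
      then have "?t \<in> K" using trace_in_fixed_field[OF gal, of a] a by (simp add: \<Gamma>_def)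
      then have gt: "g ?t = ?t" using gal_groupD(4)[OF g] by auto
      have g_sum: "(\<Oplus>\<^bsub>E\<^esub> h \<in> \<Gamma>. g (h a)) = ?t"
        using hE a by (subst gt[symmetric], subst g.hom_finsum) (auto simp: comp_def)
      have "(\<Oplus>\<^bsub>E\<^esub> j \<in> \<Gamma> <+> \<Gamma>. v j \<otimes>\<^bsub>E\<^esub> \<chi> j a) =
          (\<Oplus>\<^bsub>E\<^esub> j \<in> Inl ` \<Gamma>. v j \<otimes>\<^bsub>E\<^esub> \<chi> j a) \<oplus>\<^bsub>E\<^esub> (\<Oplus>\<^bsub>E\<^esub> j \<in> Inr ` \<Gamma>. v j \<otimes>\<^bsub>E\<^esub> \<chi> j a)"
        unfolding Plus_def using fin hE a
        by (intro E.finsum_Un_disjoint) (auto simp: v_def \<chi>_def)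
      also have "(\<Oplus>\<^bsub>E\<^esub> j \<in> Inl ` \<Gamma>. v j \<otimes>\<^bsub>E\<^esub> \<chi> j a) = (\<Oplus>\<^bsub>E\<^esub> h \<in> \<Gamma>. \<one>\<^bsub>E\<^esub> \<otimes>\<^bsub>E\<^esub> h a)"
        using hE a by (subst E.finsum_reindex) (auto simp: v_def \<chi>_def)
      also have "\<dots> = ?t" using hE a by (intro E.finsum_cong') auto
      also have "(\<Oplus>\<^bsub>E\<^esub> j \<in> Inr ` \<Gamma>. v j \<otimes>\<^bsub>E\<^esub> \<chi> j a) = (\<Oplus>\<^bsub>E\<^esub> h \<in> \<Gamma>. \<ominus>\<^bsub>E\<^esub> \<one>\<^bsub>E\<^esub> \<otimes>\<^bsub>E\<^esub> g (h a))"
        using hE a by (subst E.finsum_reindex) (auto simp: v_def \<chi>_def)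
      also have "\<dots> = \<ominus>\<^bsub>E\<^esub> \<one>\<^bsub>E\<^esub> \<otimes>\<^bsub>E\<^esub> (\<Oplus>\<^bsub>E\<^esub> h \<in> \<Gamma>. g (h a))"
        using fin hE a by (intro E.finsum_rdistr[symmetric]) auto
      also have "\<dots> = \<ominus>\<^bsub>E\<^esub> ?t" using g_sum tE by (simp add: E.l_minus)
      finally show ?thesis using tE by (simp add: E.r_neg)
    qed
  qed (use fin i \<chi>E E.carrier_is_subfield F.monoid_axioms in \<open>auto simp: v_def E.minus_eq\<close>)
  then show False by (simp add: v_def)
qed

text \<open>For \<open>z\<close> in \<open>E\<close> and \<open>a\<close> in \<open>M\<close>, the sum of \<open>g z * g a\<close> over \<open>Gal(E/K)\<close> is the trace of
  \<open>z a\<close>, so it lies in \<open>K\<close>, hence in \<open>M\<close>. The hypothesis on \<open>Gal(E/M)\<close> says that the identity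
  differs on \<open>M\<close> from every other \<open>g\<close>, so its coefficient \<open>z\<close> lies in \<open>M\<close> by independence of
  characters modulo \<open>M\<close>. The characters take values in \<open>M\<close> because \<open>Gal(E/K)\<close> preserves it.\<close>

lemma galois_subextension_eq_carrier:
  assumes galE: "galois_extension E K" and M: "subfield M E"
    and galM: "galois_extension (E\<lparr>carrier := M\<rparr>) K"
    and trivial: "\<And>g. g \<in> carrier (gal_group E M) \<Longrightarrow> g = \<one>\<^bsub>gal_group E K\<^esub>"
  shows "M = carrier E"
proof
  show ME: "M \<subseteq> carrier E" using subfieldE(3)[OF M] .
  interpret E: field E using galE by (simp add: galois_extension_def)
  let ?F = "E\<lparr>carrier := M\<rparr>" and ?G = "gal_group E K"
  interpret F: field ?F using galM by (simp add: galois_extension_def)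
  have KE: "subfield K E" "ring.finite_dimension E K (carrier E)"
    using galE by (auto simp: galois_extension_def)
  have "subfield K ?F" using galM by (simp add: galois_extension_def)
  then have KM: "K \<subseteq> M" using subfieldE(3)[of K ?F] by simp
  interpret G: group ?G using group_gal_group[OF E.ring_axioms] KM ME by simp
  have M_ring: "subring M E" using subfieldE(1)[OF M] .
  have stable: "g a \<in> M" if "g \<in> carrier ?G" "a \<in> M" for g a
    using galois_subextension_stable[OF E.field_axioms M galM that] .
  show "carrier E \<subseteq> M"
  proof
    fix z assume z: "z \<in> carrier E"
    have "(\<lambda>g. g z) \<one>\<^bsub>?G\<^esub> \<in> M"
    proof (rule E.character_coefficient_in_subspace[where M = ?F and B = M and \<chi> = "\<lambda>g. g"
          and I = "carrier ?G" and i\<^sub>0 = "\<one>\<^bsub>?G\<^esub>" and v = "\<lambda>g. g z"])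
      show "finite (carrier ?G)" by (rule finite_gal_group[OF E.field_axioms KE])
      show "g \<in> hom ?F E" if g: "g \<in> carrier ?G" for g
        using ME gal_groupD(5)[OF g] ring_hom_mult[OF gal_groupD(3)[OF g]]
        by (auto simp: hom_def subset_iff)
      show "g \<one>\<^bsub>?F\<^esub> = \<one>\<^bsub>E\<^esub>" if g: "g \<in> carrier ?G" for g
        using ring_hom_one[OF gal_groupD(3)[OF g]] by simp
      show "\<exists>x \<in> carrier ?F. g x \<noteq> \<one>\<^bsub>?G\<^esub> x" if g: "g \<in> carrier ?G - {\<one>\<^bsub>?G\<^esub>}" for g
      proof (rule ccontr)
        assume "\<not> ?thesis"
        then have "\<And>x. x \<in> M \<Longrightarrow> g x = x" using ME by (auto simp: one_gal_group subset_iff)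
        then have "g \<in> carrier (gal_group E M)" using g by (auto simp: carrier_gal_group)
        then show False using trivial g by auto
      qed
      show "(\<Oplus>\<^bsub>E\<^esub> g \<in> carrier ?G. g z \<otimes>\<^bsub>E\<^esub> g a) \<in> M" if "a \<in> carrier ?F" for a
      proof -
        have a: "a \<in> carrier E" using that ME by auto
        have "(\<Oplus>\<^bsub>E\<^esub> g \<in> carrier ?G. g z \<otimes>\<^bsub>E\<^esub> g a) = (\<Oplus>\<^bsub>E\<^esub> g \<in> carrier ?G. g (z \<otimes>\<^bsub>E\<^esub> a))"
          using z a gal_groupD(5)[of _ E K] ring_hom_mult[OF gal_groupD(3)[of _ E K], of _ z a]
          by (intro E.finsum_cong') auto
        then show ?thesis using trace_in_fixed_field[OF galE, of "z \<otimes>\<^bsub>E\<^esub> a"] z a KM by auto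
      qed
      show "u \<ominus>\<^bsub>E\<^esub> w \<in> M" if "u \<in> M" "w \<in> M" for u w
        unfolding E.minus_eq using subringE(5,7)[OF M_ring] that by auto
      show "(\<lambda>g. g z) \<in> carrier ?G \<rightarrow> carrier E" using gal_groupD(5) z by auto
    qed (use F.monoid_axioms M ME subringE(6)[OF M_ring] stable in auto)
    then show "z \<in> M" using z by (simp add: one_gal_group)
  qed
qed


section \<open>Actions on cosets\<close>

lemma (in group) stabilizer_coset_action:
  assumes S: "subgroup S G"
  shows "stabilizer G (coset_action G S) S = S"
proof -
  have "S \<subseteq> carrier G" using S subgroup.subset by auto
  then have "S \<in> lcosets S" using lcos_mult_one[of S] by (force simp: LCOSETS_def)
  then show ?thesis
    using \<open>S \<subseteq> carrier G\<close> coset_join3[OF _ S] lcos_self[OF _ S]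
    by (auto simp: stabilizer_def coset_action_def)
qed

text \<open>The kernel of the action on \<open>G/S\<close> is the intersection of the conjugates of \<open>S\<close>.\<close>

lemma (in group) faithful_coset_action_core_trivial:
  assumes S: "subgroup S G" and faithful: "faithful_action G (lcosets S) (coset_action G S)"
    and g: "g \<in> carrier G"
    and conj: "\<And>h. h \<in> carrier G \<Longrightarrow> inv h \<otimes> (g \<otimes> h) \<in> S"
  shows "g = \<one>"
proof -
  have SG: "S \<subseteq> carrier G" using S subgroup.subset by auto
  have "g <# C = \<one> <# C" if C: "C \<in> lcosets S" for C
  proof -
    obtain h where h: "h \<in> carrier G" "C = h <# S" using C by (auto simp: LCOSETS_def)
    have "h \<otimes> (inv h \<otimes> (g \<otimes> h)) = g \<otimes> h" using h g by (simp add: m_assoc[symmetric])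
    then have "g <# C = (h \<otimes> (inv h \<otimes> (g \<otimes> h))) <# S" using h g SG by (simp add: lcos_m_assoc)
    also have "\<dots> = h <# ((inv h \<otimes> (g \<otimes> h)) <# S)" using h g SG by (subst lcos_m_assoc) auto
    also have "(inv h \<otimes> (g \<otimes> h)) <# S = S" using coset_join3[OF _ S] conj[OF h(1)] h g by simp
    finally show ?thesis using h SG by (simp add: lcos_mult_one l_coset_subset_G)
  qed
  then have "coset_action G S g = coset_action G S \<one>"
    unfolding coset_action_def by (rule restrict_ext)
  then show ?thesis using faithful_action.faithful[OF faithful] g by (auto dest: inj_onD)
qed

text \<open>If \<open>M\<close> contains \<open>L\<close> and is Galois over \<open>K\<close>, and \<open>g\<close> fixes \<open>M\<close>, then for every \<open>h\<close> in
  \<open>Gal(E/K)\<close> the conjugate of \<open>g\<close> by \<open>h\<close> fixes \<open>L\<close>, because \<open>h\<close> maps \<open>L\<close> into \<open>M\<close>. So \<open>g\<close> acts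
  trivially on the cosets of \<open>Gal(E/L)\<close>.\<close>

lemma galois_closure_of_faithful_coset_action:
  assumes gal: "galois_extension E K" and L: "subfield L E" "K \<subseteq> L"
    and faithful: "faithful_action (gal_group E K)
      (lcosets\<^bsub>gal_group E K\<^esub> (carrier (gal_group E L)))
      (coset_action (gal_group E K) (carrier (gal_group E L)))"
  shows "is_galois_closure E K L M \<longleftrightarrow> M = carrier E"
proof -
  let ?G = "gal_group E K" and ?S = "carrier (gal_group E L)"
  interpret E: field E using gal by (simp add: galois_extension_def)
  have LE: "L \<subseteq> carrier E" using subfieldE(3)[OF L(1)] .
  interpret G: group ?G using group_gal_group[OF E.ring_axioms] L(2) LE by simp
  have S: "subgroup ?S ?G" using gal_group_subgroup_mono[OF E.ring_axioms L(2) LE] .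
  have eq: "M' = carrier E"
    if M': "subfield M' E" "L \<subseteq> M'" "galois_extension (E\<lparr>carrier := M'\<rparr>) K" for M'
  proof (rule galois_subextension_eq_carrier[OF gal M'(1,3)])
    fix g assume g: "g \<in> carrier (gal_group E M')"
    have gG: "g \<in> carrier ?G" using g L(2) M'(2) by (auto simp: carrier_gal_group)
    have M'E: "M' \<subseteq> carrier E" using subfieldE(3)[OF M'(1)] .
    show "g = \<one>\<^bsub>?G\<^esub>"
    proof (rule G.faithful_coset_action_core_trivial[OF S faithful gG])
      fix h assume h: "h \<in> carrier ?G"
      let ?k = "inv\<^bsub>?G\<^esub> h \<otimes>\<^bsub>?G\<^esub> (g \<otimes>\<^bsub>?G\<^esub> h)"
      have ih: "inv\<^bsub>?G\<^esub> h \<in> carrier ?G" using h by (rule G.inv_closed)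
      have k: "?k \<in> carrier ?G" using ih h gG by (intro G.m_closed)
      have "?k x = x" if x: "x \<in> L" for x
      proof -
        have xE: "x \<in> carrier E" using x LE by auto
        have "h x \<in> M'"
          using galois_subextension_stable[OF E.field_axioms M'(1,3) h] x M'(2) by auto
        then have "g (h x) = h x" using gal_groupD(4)[OF g] by auto
        then have "?k x = (inv\<^bsub>?G\<^esub> h \<otimes>\<^bsub>?G\<^esub> h) x"
          using mult_gal_group[OF ih G.m_closed[OF gG h]] mult_gal_group[OF gG h] mult_gal_group[OF ih h] xE
          by (simp add: compose_def)
        also have "\<dots> = x" using G.l_inv[OF h] xE by (simp add: one_gal_group)
        finally show ?thesis .
      qed
      then show "?k \<in> ?S" using k unfolding carrier_gal_group by blast
    qed
  qed
  have "galois_extension (E\<lparr>carrier := carrier E\<rparr>) K" using gal by simp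
  then have "is_galois_closure E K L (carrier E)"
    unfolding is_galois_closure_def using LE eq E.carrier_is_subfield by blast
  then show ?thesis using eq unfolding is_galois_closure_def by blast
qed


theorem corollary5p1:
  fixes E :: "('a, 'b) ring_scheme" and K L :: "'a set"
    and G :: "('a \<Rightarrow> 'a) monoid" and S :: "('a \<Rightarrow> 'a) set"
    and star :: "('a \<Rightarrow> 'a) set \<Rightarrow> ('a \<Rightarrow> 'a) set \<Rightarrow> ('a \<Rightarrow> 'a) set"
    and N :: "('a \<Rightarrow> 'a) set monoid"
    and H :: "('a, 'h) module" and comult :: "'h \<Rightarrow> ('h \<times> 'h) list set"
    and counit :: "'h \<Rightarrow> 'a" and antipode :: "'h \<Rightarrow> 'h" and actH :: "'h \<Rightarrow> 'a \<Rightarrow> 'a"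
  assumes E_galois: "galois_extension E K"
    and L_intermediate: "subfield L E" "K \<subseteq> L"
    and L_finite: "ring.finite_dimension E K L"
    and L_separable: "field.separable_extension E K L"
    and G: "G = gal_group E K"
    and S: "S = carrier (gal_group E L)"
    and N: "N = coset_monoid G S star"
    and bracoid: "skew_bracoid G N (coset_action G S)"
    and hopf_galois: "hopf_galois_structure (E \<lparr> carrier := K \<rparr>) (subfield_algebra E L)
      H comult counit antipode actH"
    and corresponds: "corresponds_to_bracoid E K L G N (coset_action G S)
      H comult counit antipode actH"
  shows "(almost_a_brace G N (coset_action G S) \<longleftrightarrow> has_normal_complement G S) \<and>
    (reduced_bracoid G N (coset_action G S) \<longrightarrow>
      (almost_a_brace G N (coset_action G S) \<longleftrightarrow> almost_classical E K L))"
proof -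
  interpret bracoid: skew_bracoid G N "coset_action G S" by (rule bracoid)
  have E: "ring E"
    using E_galois by (simp add: galois_extension_def cring.axioms domain.axioms field.axioms)
  have S_sub: "subgroup S G"
    unfolding G S using gal_group_subgroup_mono[OF E L_intermediate(2) subfieldE(3)[OF L_intermediate(1)]] .
  have "\<one>\<^bsub>N\<^esub> = S" "carrier N = lcosets\<^bsub>G\<^esub> S" by (simp_all add: N coset_monoid_def)
  then have brace: "almost_a_brace G N (coset_action G S) \<longleftrightarrow> has_normal_complement G S"
    using bracoid bracoid.stabilizer_coset_action[OF S_sub] by (simp add: almost_a_brace_def)
  moreover have "almost_classical E K L \<longleftrightarrow> has_normal_complement G S"
    if "reduced_bracoid G N (coset_action G S)"
  proof -
    have "faithful_action G (lcosets\<^bsub>G\<^esub> S) (coset_action G S)"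
      using that \<open>carrier N = lcosets\<^bsub>G\<^esub> S\<close> by (simp add: reduced_bracoid_def)
    then have "is_galois_closure E K L M \<longleftrightarrow> M = carrier E" for M
      using galois_closure_of_faithful_coset_action[OF E_galois L_intermediate] unfolding G S by blast
    then show ?thesis by (simp add: almost_classical_def G S)
  qed
  ultimately show ?thesis by blast
qed

end
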